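(* There exist Hilbert spaces $H_1,H_2,H_4,H_5$ over the same field and operators $A_1\in\mathcal{L}_c(H_1,H_4)$, $A_2\in\mathcal{L}_c(H_1,H_5)$, $B_1\in\mathcal{L}_c(H_2,H_4)$, $B_2\in\mathcal{L}_c(H_2,H_5)$ such that, with $A=(A_1,A_2):H_1\to H_4\times H_5$ and $B=(B_1,B_2):H_2\to H_4\times H_5$, both of the following conditions hold: (i) there exists $C>0$ such that for any $h_4\in H_4$, $\|A_1^*h_4\|_1\leqslant C\|B_1^*h_4\|_2$, and $\mathcal{N}(B^* )\subset\mathcal{N}(A^* )$; (ii) $A_1=B_1C_1$ for some $C_1\in\mathcal{L}_c(H_1,H_2)$, and $A^*=DB^*$ for some $D\in\mathcal{L}(H_2,H_1)$ not necessarily continuous; but the following property fails: for any $h_1\in H_1$ and any $\varepsilon>0$, there exists $h_2\in H_2$ such that $A_1h_1=B_1h_2$ and $\|A_2h_1-B_2h_2\|_5\leqslant\varepsilon$.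
   Context: $\mathcal{L}_c(E,F)$ denotes the set of continuous linear maps from $E$ to $F$; $\mathcal{L}(E,F)$ denotes the set of all linear maps from $E$ to $F$, not necessarily continuous. $\mathcal{N}(T)$ is the kernel of $T$, $T^*$ is the Hilbert space adjoint of $T$, and $\|\cdot\|_i$ is the norm of $H_i$. The product $H_4\times H_5$ carries the Hilbertian norm $\|(h_4,h_5)\|^2=\|h_4\|_4^2+\|h_5\|_5^2$, so that $A^*(h_4,h_5)=A_1^*h_4+A_2^*h_5$ and $B^*(h_4,h_5)=B_1^*h_4+B_2^*h_5$. *)

theory Defs
  imports "HOL-Analysis.Analysis" "HOL-Algebra.Algebra"
begin

text \<open>
  Hilbert spaces are formalised with explicit carriers, as extensions of the module records of
  HOL-Algebra, so that one can quantify over them inside a formula. The scalar field is a set \<open>K\<close>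
  of complex numbers, either \<open>\<real>\<close> or \<open>UNIV\<close>. The record fields \<open>mult\<close> and \<open>one\<close> that a module
  inherits from rings carry no information.
\<close>

definition scalar_field :: "complex set \<Rightarrow> complex ring" where
  "scalar_field K =
     \<lparr>carrier = K, monoid.mult = (*), one = 1, ring.zero = 0, add = (+)\<rparr>"

record 'a hilb = "(complex, 'a) module" +
  ip :: "'a \<Rightarrow> 'a \<Rightarrow> complex"

definition hnorm :: "('a, 'm) hilb_scheme \<Rightarrow> 'a \<Rightarrow> real" where
  "hnorm H x = sqrt (Re (ip H x x))"

text \<open>The locale \<open>Metric_space\<close> constrains the distance off the carrier as well, hence the case
  distinction.\<close>

definition hdist :: "('a, 'm) hilb_scheme \<Rightarrow> 'a \<Rightarrow> 'a \<Rightarrow> real" where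
  "hdist H x y =
     (if x \<in> carrier H \<and> y \<in> carrier H then hnorm H (x \<ominus>\<^bsub>H\<^esub> y) else 0)"

locale inner_product_space = module "scalar_field K" H
  for K :: "complex set" and H :: "('a, 'm) hilb_scheme" (structure) +
  assumes scalars: "K = \<real> \<or> K = UNIV"
    and ip_closed: "\<lbrakk>x \<in> carrier H; y \<in> carrier H\<rbrakk> \<Longrightarrow> ip H x y \<in> K"
    and ip_add_left: "\<lbrakk>x \<in> carrier H; y \<in> carrier H; z \<in> carrier H\<rbrakk>
      \<Longrightarrow> ip H (x \<oplus> y) z = ip H x z + ip H y z"
    and ip_smult_left: "\<lbrakk>a \<in> K; x \<in> carrier H; y \<in> carrier H\<rbrakk>
      \<Longrightarrow> ip H (a \<odot> x) y = a * ip H x y"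
    and ip_cnj: "\<lbrakk>x \<in> carrier H; y \<in> carrier H\<rbrakk> \<Longrightarrow> ip H y x = cnj (ip H x y)"
    and ip_nonneg: "x \<in> carrier H \<Longrightarrow> 0 \<le> Re (ip H x x)"
    and ip_definite: "\<lbrakk>x \<in> carrier H; ip H x x = 0\<rbrakk> \<Longrightarrow> x = \<zero>"

context inner_product_space
begin

lemma scalar_simps [simp]: "carrier (scalar_field K) = K" "\<one>\<^bsub>scalar_field K\<^esub> = 1"
  "\<zero>\<^bsub>scalar_field K\<^esub> = 0" "a \<oplus>\<^bsub>scalar_field K\<^esub> b = a + b" "a \<otimes>\<^bsub>scalar_field K\<^esub> b = a * b"
  by (simp_all add: scalar_field_def)

lemma ip_add_right:
  assumes "x \<in> carrier H" "y \<in> carrier H" "z \<in> carrier H"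
  shows "ip H z (x \<oplus> y) = ip H z x + ip H z y"
  using assms by (metis M.add.m_closed complex_cnj_add ip_add_left ip_cnj)

lemma ip_zero_left: "y \<in> carrier H \<Longrightarrow> ip H \<zero> y = 0"
  using ip_add_left[of \<zero> \<zero> y] by simp

lemma ip_zero_right: "y \<in> carrier H \<Longrightarrow> ip H y \<zero> = 0"
  using ip_add_right[of \<zero> \<zero> y] by simp

lemma ip_minus_left: 
  assumes "x \<in> carrier H" "y \<in> carrier H" shows "ip H (\<ominus> x) y = - ip H x y"
  using ip_add_left[of x "\<ominus> x" y] assms ip_zero_left[of y] by (simp add: M.r_neg add_eq_0_iff)

lemma ip_minus_right: 
  assumes "x \<in> carrier H" "y \<in> carrier H" shows "ip H y (\<ominus> x) = - ip H y x"
  using ip_add_right[of x "\<ominus> x" y] assms ip_zero_right[of y] by (simp add: M.r_neg add_eq_0_iff)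

lemma ip_smult_right:
  assumes "a \<in> K" "x \<in> carrier H" "y \<in> carrier H" shows "ip H y (a \<odot> x) = cnj a * ip H y x"
proof -
  have "a \<odot> x \<in> carrier H" using assms by (intro smult_closed) auto
  then show ?thesis using assms by (metis complex_cnj_mult ip_cnj ip_smult_left)
qed

lemma ip_self: "x \<in> carrier H \<Longrightarrow> ip H x x = of_real ((hnorm H x)\<^sup>2)"
  unfolding hnorm_def using ip_nonneg[of x] ip_cnj[of x x]
  by (simp add: complex_eq_iff)

lemma hnorm_nonneg: "x \<in> carrier H \<Longrightarrow> 0 \<le> hnorm H x"
  by (simp add: hnorm_def ip_nonneg)

lemma hnorm_0_iff: "x \<in> carrier H \<Longrightarrow> hnorm H x = 0 \<longleftrightarrow> x = \<zero>"
  using ip_definite[of x] ip_self[of x] by (metis M.zero_closed hnorm_def ip_zero_left of_real_0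
      power_zero_numeral real_sqrt_zero zero_complex.sel(1))

lemma Cauchy_Schwarz:
  assumes x: "x \<in> carrier H" and y: "y \<in> carrier H"
  shows "cmod (ip H x y) \<le> hnorm H x * hnorm H y"
proof (cases "y = \<zero>")
  case True then show ?thesis using x hnorm_0_iff[of \<zero>] by (simp add: ip_zero_right)
next
  case False
  define n where "n = hnorm H y"
  have n: "n > 0" using False hnorm_0_iff[OF y] hnorm_nonneg[OF y] by (simp add: n_def)
  define t where "t = ip H x y / of_real (n\<^sup>2)"
  have tK: "t \<in> K" using scalars ip_closed[OF x y] unfolding t_def by (auto simp del: of_real_power)
  have ty: "t \<odot> y \<in> carrier H" using tK y by (intro smult_closed) auto
  have xy: "ip H y x = cnj (ip H x y)" using ip_cnj[OF x y] .
  let ?z = "x \<oplus> \<ominus> (t \<odot> y)"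
  have z: "?z \<in> carrier H" using x ty by simp
  have "ip H ?z ?z = ip H x x - t * ip H y x - cnj t * ip H x y + t * cnj t * ip H y y"
    using x y ty tK by (simp add: ip_add_left ip_add_right ip_minus_left ip_minus_right
       ip_smult_left ip_smult_right algebra_simps)
  also have "\<dots> = of_real ((hnorm H x)\<^sup>2 - (cmod (ip H x y))\<^sup>2 / n\<^sup>2)"
    using n x y complex_norm_square[of "ip H x y"]
    by (simp add: ip_self xy n_def[symmetric] t_def power2_eq_square field_simps)
  finally have "0 \<le> (hnorm H x)\<^sup>2 - (cmod (ip H x y))\<^sup>2 / n\<^sup>2"
    using ip_nonneg[OF z] by simp
  then have "(cmod (ip H x y))\<^sup>2 \<le> (hnorm H x * n)\<^sup>2" using n by (simp add: field_simps)
  then show ?thesis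
    unfolding n_def by (rule power2_le_imp_le) (simp add: hnorm_nonneg x y)
qed

lemma hnorm_triangle:
  assumes x: "x \<in> carrier H" and y: "y \<in> carrier H"
  shows "hnorm H (x \<oplus> y) \<le> hnorm H x + hnorm H y"
proof -
  have "complex_of_real ((hnorm H (x \<oplus> y))\<^sup>2) = ip H (x \<oplus> y) (x \<oplus> y)"
    using x y by (simp only: ip_self M.add.m_closed)
  also have "\<dots> = ip H x x + ip H y y + (ip H x y + cnj (ip H x y))"
    using x y ip_cnj[OF x y] by (simp add: ip_add_left ip_add_right)
  also have "\<dots> = of_real ((hnorm H x)\<^sup>2 + (hnorm H y)\<^sup>2 + 2 * Re (ip H x y))"
    using x y by (simp add: ip_self complex_add_cnj)
  finally have "(hnorm H (x \<oplus> y))\<^sup>2 = (hnorm H x)\<^sup>2 + (hnorm H y)\<^sup>2 + 2 * Re (ip H x y)"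
    using of_real_eq_iff by blast
  also have "\<dots> \<le> (hnorm H x + hnorm H y)\<^sup>2"
    using Cauchy_Schwarz[OF x y] complex_Re_le_cmod[of "ip H x y"] by (simp add: power2_sum)
  finally show ?thesis
    by (rule power2_le_imp_le) (simp add: hnorm_nonneg x y)
qed

lemma hnorm_minus: "x \<in> carrier H \<Longrightarrow> hnorm H (\<ominus> x) = hnorm H x"
  by (simp add: hnorm_def ip_minus_left ip_minus_right)

lemma a_minus_eq_zero_iff:
  assumes "x \<in> carrier H" "y \<in> carrier H"
  shows "x \<ominus> y = \<zero> \<longleftrightarrow> x = y"
  using assms M.minus_equality[of x "\<ominus> y"] by (auto simp: a_minus_def M.r_neg)

lemma Metric_space_hdist: "Metric_space (carrier H) (hdist H)"
proof
  fix x y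
  show "0 \<le> hdist H x y" by (simp add: hdist_def hnorm_nonneg)
  show "hdist H x y = hdist H y x"
  proof (cases "x \<in> carrier H \<and> y \<in> carrier H")
    case True
    then have "\<ominus> (x \<ominus> y) = y \<ominus> x"
      by (simp add: a_minus_def M.minus_add M.a_comm)
    then show ?thesis
      using True hnorm_minus[of "x \<ominus> y"] by (simp add: hdist_def)
  next
    case False
    then show ?thesis by (auto simp: hdist_def)
  qed
next
  fix x y assume "x \<in> carrier H" "y \<in> carrier H"
  then show "hdist H x y = 0 \<longleftrightarrow> x = y"
    by (simp add: hdist_def hnorm_0_iff a_minus_eq_zero_iff)
next
  fix x y z assume a: "x \<in> carrier H" "y \<in> carrier H" "z \<in> carrier H"
  have "x \<ominus> z = (x \<ominus> y) \<oplus> (y \<ominus> z)"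
    using a by (simp add: a_minus_def M.a_assoc M.r_neg1 )
  then show "hdist H x z \<le> hdist H x y + hdist H y z"
    using a hnorm_triangle[of "x \<ominus> y" "y \<ominus> z"] by (simp add: hdist_def)
qed

end

locale hilbert_space = inner_product_space +
  assumes complete: "Metric_space.mcomplete (carrier H) (hdist H)"

abbreviation htopology :: "('a, 'm) hilb_scheme \<Rightarrow> 'a topology" where
  "htopology H \<equiv> Metric_space.mtopology (carrier H) (hdist H)"

text \<open>Operators matter only through their values on the carrier of their domain.\<close>

definition linear_maps ::
  "complex set \<Rightarrow> ('a, 'm) hilb_scheme \<Rightarrow> ('b, 'n) hilb_scheme \<Rightarrow> ('a \<Rightarrow> 'b) set" where
  "linear_maps K E F = {T \<in> carrier E \<rightarrow> carrier F.
     (\<forall>x\<in>carrier E. \<forall>y\<in>carrier E. T (x \<oplus>\<^bsub>E\<^esub> y) = T x \<oplus>\<^bsub>F\<^esub> T y) \<and>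
     (\<forall>a\<in>K. \<forall>x\<in>carrier E. T (a \<odot>\<^bsub>E\<^esub> x) = a \<odot>\<^bsub>F\<^esub> T x)}"

definition continuous_linear_maps ::
  "complex set \<Rightarrow> ('a, 'm) hilb_scheme \<Rightarrow> ('b, 'n) hilb_scheme \<Rightarrow> ('a \<Rightarrow> 'b) set" where
  "continuous_linear_maps K E F =
     {T \<in> linear_maps K E F. continuous_map (htopology E) (htopology F) T}"

text \<open>For a continuous linear \<open>T\<close> from \<open>E\<close> to \<open>F\<close>, the description below is well defined by the
  Riesz representation theorem.\<close>

definition adjoint_map ::
  "('a, 'm) hilb_scheme \<Rightarrow> ('b, 'n) hilb_scheme \<Rightarrow> ('a \<Rightarrow> 'b) \<Rightarrow> 'b \<Rightarrow> 'a" where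
  "adjoint_map E F T y =
     (THE z. z \<in> carrier E \<and> (\<forall>x\<in>carrier E. ip F (T x) y = ip E x z))"

lemma adjoint_map_eqI:
  assumes "inner_product_space K E" "z \<in> carrier E"
    "\<And>x. x \<in> carrier E \<Longrightarrow> ip F (T x) y = ip E x z"
  shows "adjoint_map E F T y = z"
  unfolding adjoint_map_def
proof (rule the_equality)
  interpret inner_product_space K E by fact
  fix w assume w: "w \<in> carrier E \<and> (\<forall>x\<in>carrier E. ip F (T x) y = ip E x w)"
  have eq: "ip E x w = ip E x z" if "x \<in> carrier E" for x
    using w assms(3)[OF that] that by simp
  have "ip E (w \<ominus>\<^bsub>E\<^esub> z) (w \<ominus>\<^bsub>E\<^esub> z) = 0"
    using w assms(2) by (simp add: a_minus_def ip_add_right ip_minus_right eq)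
  then have "w \<ominus>\<^bsub>E\<^esub> z = \<zero>\<^bsub>E\<^esub>" using w assms(2) by (intro ip_definite) auto
  then show "w = z" using w assms(2) by (simp add: a_minus_eq_zero_iff)
qed (use assms in auto)

definition hprod :: "'a hilb \<Rightarrow> 'b hilb \<Rightarrow> ('a \<times> 'b) hilb" (infixr \<open>\<times>\<^sub>H\<close> 80) where
  "E \<times>\<^sub>H F =
     \<lparr>carrier = carrier E \<times> carrier F,
      monoid.mult = undefined, one = undefined,
      ring.zero = (\<zero>\<^bsub>E\<^esub>, \<zero>\<^bsub>F\<^esub>),
      add = (\<lambda>(x, y) (x', y'). (x \<oplus>\<^bsub>E\<^esub> x', y \<oplus>\<^bsub>F\<^esub> y')),
      smult = (\<lambda>a (x, y). (a \<odot>\<^bsub>E\<^esub> x, a \<odot>\<^bsub>F\<^esub> y)),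
      ip = (\<lambda>(x, y) (x', y'). ip E x x' + ip F y y')\<rparr>"

lemma inner_product_space_hprod:
  assumes "inner_product_space K E" "inner_product_space K F"
  shows "inner_product_space K (E \<times>\<^sub>H F)"
proof -
  interpret E: inner_product_space K E by fact
  interpret F: inner_product_space K F by fact
  let ?P = "E \<times>\<^sub>H F"
  have carrier: "carrier ?P = carrier E \<times> carrier F" by (simp add: hprod_def)
  have add: "(x, y) \<oplus>\<^bsub>?P\<^esub> (x', y') = (x \<oplus>\<^bsub>E\<^esub> x', y \<oplus>\<^bsub>F\<^esub> y')" for x y x' y'
    by (simp add: hprod_def)
  have zero: "\<zero>\<^bsub>?P\<^esub> = (\<zero>\<^bsub>E\<^esub>, \<zero>\<^bsub>F\<^esub>)" by (simp add: hprod_def)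
  have smult: "a \<odot>\<^bsub>?P\<^esub> (x, y) = (a \<odot>\<^bsub>E\<^esub> x, a \<odot>\<^bsub>F\<^esub> y)" for a x y
    by (simp add: hprod_def)
  have ip: "ip ?P (x, y) (x', y') = ip E x x' + ip F y y'" for x y x' y'
    by (simp add: hprod_def)
  have ab: "abelian_group ?P"
  proof (rule abelian_groupI)
    fix p assume "p \<in> carrier ?P"
    then obtain x y where p: "p = (x, y)" "x \<in> carrier E" "y \<in> carrier F"
      by (auto simp: carrier)
    show "\<exists>q\<in>carrier ?P. q \<oplus>\<^bsub>?P\<^esub> p = \<zero>\<^bsub>?P\<^esub>"
      by (rule bexI[of _ "(\<ominus>\<^bsub>E\<^esub> x, \<ominus>\<^bsub>F\<^esub> y)"])
        (use p in \<open>simp_all add: carrier add zero E.M.l_neg F.M.l_neg\<close>)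
  qed (auto simp: carrier add zero E.M.a_ac F.M.a_ac)
  have m: "module (scalar_field K) ?P"
    by (rule moduleI[OF E.R.is_cring ab])
      (use E.smult_closed F.smult_closed E.smult_l_distr F.smult_l_distr
        E.smult_r_distr F.smult_r_distr E.smult_assoc1 F.smult_assoc1 E.smult_one F.smult_one
        in \<open>auto simp: carrier add smult\<close>)
  have def: "ip E a a + ip F b b = 0 \<Longrightarrow> a = \<zero>\<^bsub>E\<^esub> \<and> b = \<zero>\<^bsub>F\<^esub>" if "a \<in> carrier E" "b \<in> carrier F" for a b
  proof -
    assume "ip E a a + ip F b b = 0"
    then have "(hnorm E a)\<^sup>2 + (hnorm F b)\<^sup>2 = 0" using that E.ip_self[of a] F.ip_self[of b]
      by (metis of_real_add of_real_eq_0_iff)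
    then show ?thesis using that E.hnorm_0_iff F.hnorm_0_iff by (simp add: sum_power2_eq_zero_iff)
  qed
  show ?thesis
  proof (rule inner_product_space.intro[OF m], unfold_locales)
    show "K = \<real> \<or> K = UNIV" by (rule E.scalars)
  next
    fix p q assume "p \<in> carrier ?P" "q \<in> carrier ?P"
    then obtain x y x' y' where p: "p = (x, y)" "x \<in> carrier E" "y \<in> carrier F"
      and q: "q = (x', y')" "x' \<in> carrier E" "y' \<in> carrier F"
      by (auto simp: carrier)
    show "ip ?P p q \<in> K"
      using p q E.scalars E.ip_closed[of x x'] F.ip_closed[of y y'] by (auto simp: ip)
    show "ip ?P q p = cnj (ip ?P p q)"
      using p q E.ip_cnj[of x x'] F.ip_cnj[of y y'] by (simp add: ip)
  qed (auto simp: carrier add zero smult ip E.ip_add_left F.ip_add_left E.ip_smult_left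
      F.ip_smult_left algebra_simps E.ip_nonneg F.ip_nonneg def)
qed

lemma hnorm_hprod:
  "hnorm (E \<times>\<^sub>H F) (a,b) ^2 = hnorm E a ^2 + hnorm F b^2"
  if "inner_product_space K E" "inner_product_space K F" "a \<in> carrier E" "b \<in> carrier F"
  using inner_product_space.ip_nonneg[OF that(1,3)] inner_product_space.ip_nonneg[OF that(2,4)]
  by (simp add: hnorm_def hprod_def)

end

theory Submission
  imports Defs "HOL-Library.Function_Algebras"
begin

text \<open>
  Multiplication by the harmonic sequence \<open>u = (1/(n+1))\<close> is an injective contraction \<open>M\<close> on the
  complex space \<open>\<ell>\<^sup>2\<close>, and \<open>u\<close> lies in \<open>\<ell>\<^sup>2\<close> but not in the range of \<open>M\<close>, because its only
  preimage would be the constant sequence 1. The example takes \<open>H\<^sub>2 = H\<^sub>4 = \<ell>\<^sup>2\<close>,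
  \<open>H\<^sub>1 = H\<^sub>5 = \<complex>\<close>, \<open>A\<^sub>1 = 0\<close>, \<open>A\<^sub>2 = id\<close>, \<open>B\<^sub>1 = M\<close> and \<open>B\<^sub>2 = \<langle>_, u\<rangle>\<close>.

  The approximation property fails because \<open>B\<^sub>1\<close> is injective: \<open>B\<^sub>1 h\<^sub>2 = A\<^sub>1 h\<^sub>1 = 0\<close> forces \<open>h\<^sub>2 = 0\<close>,
  so the second component stays at distance \<open>\<bar>h\<^sub>1\<bar>\<close> from \<open>A\<^sub>2 h\<^sub>1 = h\<^sub>1\<close>. On the dual side
  \<open>A\<^sup>*(h, k) = k\<close> and \<open>B\<^sup>*(h, k) = M h + k u\<close>. Since \<open>A\<^sub>1 = 0\<close>, the estimate of the adjoints and
  the factorisation through \<open>C\<^sub>1 = 0\<close> are immediate. Since \<open>u\<close> is not in the range of \<open>M\<close>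
  (\<open>harmonic_notin_range\<close>), \<open>B\<^sup>*(h, k) = 0\<close> implies \<open>k = 0\<close>, which is the inclusion of kernels
  (\<open>harmonic_pair_adjoint_kernel\<close>). For the same reason some linear functional vanishes on the range
  of \<open>M\<close> and maps \<open>u\<close> to 1 (\<open>harmonic_functional\<close>); it is the operator \<open>D\<close>. It comes from a Hamel
  basis and cannot be continuous, the range of \<open>M\<close> being dense. This density is what
  separates the two conditions from the approximation property: \<open>(0, 1)\<close> belongs to the closure of
  the range of \<open>B\<close>, but it is approached only along vectors whose first component is nonzero.
\<close>

section \<open>Square-summable sequences\<close>

text \<open>The support set \<open>I\<close> lets one construction provide both \<open>\<ell>\<^sup>2\<close>, with \<open>I = UNIV\<close>, and the
  one-dimensional space, with \<open>I = {0}\<close>, as spaces of sequences.\<close>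

definition ell2 :: "nat set \<Rightarrow> (nat \<Rightarrow> complex) hilb" where
  "ell2 I =
     \<lparr>carrier = {f. (\<forall>n. n \<notin> I \<longrightarrow> f n = 0) \<and> summable (\<lambda>n. (cmod (f n))\<^sup>2)},
      monoid.mult = undefined, one = undefined,
      ring.zero = (\<lambda>n. 0),
      add = (\<lambda>f g n. f n + g n),
      smult = (\<lambda>a f n. a * f n),
      ip = (\<lambda>f g. suminf (\<lambda>n. f n * cnj (g n)))\<rparr>"

lemma ell2_simps [simp]:
  "carrier (ell2 I) = {f. (\<forall>n. n \<notin> I \<longrightarrow> f n = 0) \<and> summable (\<lambda>n. (cmod (f n))\<^sup>2)}"
  "\<zero>\<^bsub>ell2 I\<^esub> = (\<lambda>n. 0)"
  "f \<oplus>\<^bsub>ell2 I\<^esub> g = (\<lambda>n. f n + g n)"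
  "a \<odot>\<^bsub>ell2 I\<^esub> f = (\<lambda>n. a * f n)"
  "ip (ell2 I) f g = suminf (\<lambda>n. f n * cnj (g n))"
  by (simp_all add: ell2_def)

lemma summable_square_add:
  fixes f g :: "nat \<Rightarrow> complex"
  assumes "summable (\<lambda>n. (cmod (f n))\<^sup>2)" "summable (\<lambda>n. (cmod (g n))\<^sup>2)"
  shows "summable (\<lambda>n. (cmod (f n + g n))\<^sup>2)"
proof (rule summable_comparison_test')
  show "summable (\<lambda>n. 2 * (cmod (f n))\<^sup>2 + 2 * (cmod (g n))\<^sup>2)"
    using assms by (intro summable_add summable_mult)
  fix n
  have "(cmod (f n + g n))\<^sup>2 \<le> (cmod (f n) + cmod (g n))\<^sup>2"
    by (simp add: norm_triangle_ineq power_mono)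
  also have "\<dots> \<le> 2 * (cmod (f n))\<^sup>2 + 2 * (cmod (g n))\<^sup>2"
    using sum_squares_bound[of "cmod (f n)" "cmod (g n)"] by (simp add: power2_sum)
  finally show "norm ((cmod (f n + g n))\<^sup>2) \<le> 2 * (cmod (f n))\<^sup>2 + 2 * (cmod (g n))\<^sup>2"
    by simp
qed

lemma summable_square_mult:
  fixes f :: "nat \<Rightarrow> complex"
  assumes "summable (\<lambda>n. (cmod (f n))\<^sup>2)"
  shows "summable (\<lambda>n. (cmod (a * f n))\<^sup>2)"
  using summable_mult[OF assms, of "(cmod a)\<^sup>2"] by (simp add: norm_mult power_mult_distrib)

lemma summable_inner:
  fixes f g :: "nat \<Rightarrow> complex"
  assumes "summable (\<lambda>n. (cmod (f n))\<^sup>2)" "summable (\<lambda>n. (cmod (g n))\<^sup>2)"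
  shows "summable (\<lambda>n. f n * cnj (g n))"
proof (rule summable_norm_cancel, rule summable_comparison_test')
  show "summable (\<lambda>n. (cmod (f n))\<^sup>2 + (cmod (g n))\<^sup>2)"
    using assms by (intro summable_add)
  fix n
  show "norm (norm (f n * cnj (g n))) \<le> (cmod (f n))\<^sup>2 + (cmod (g n))\<^sup>2"
    using sum_squares_bound[of "cmod (f n)" "cmod (g n)"]
      mult_nonneg_nonneg[OF norm_ge_zero[of "f n"] norm_ge_zero[of "g n"]]
    unfolding real_norm_def norm_mult complex_mod_cnj abs_mult abs_norm_cancel by linarith
qed

lemma ell2_inner_self:
  assumes "summable (\<lambda>n. (cmod (f n))\<^sup>2)"
  shows "suminf (\<lambda>n. f n * cnj (f n)) = of_real (suminf (\<lambda>n. (cmod (f n))\<^sup>2))"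
  using suminf_of_real[OF assms, where 'a = complex] complex_norm_square
  by (simp flip: complex_norm_square)

lemma inner_product_space_ell2: "inner_product_space UNIV (ell2 I)"
proof -
  have cring: "cring (scalar_field UNIV)"
  proof (rule cringI)
    show "abelian_group (scalar_field UNIV)"
      by (rule abelian_groupI) (auto simp: scalar_field_def algebra_simps intro: exI[of _ "- x" for x])
    show "comm_monoid (scalar_field UNIV)"
      by (rule comm_monoidI) (auto simp: scalar_field_def)
  qed (auto simp: scalar_field_def algebra_simps)
  have ab: "abelian_group (ell2 I)"
  proof (rule abelian_groupI)
    fix f assume "f \<in> carrier (ell2 I)"
    then show "\<exists>g\<in>carrier (ell2 I). g \<oplus>\<^bsub>ell2 I\<^esub> f = \<zero>\<^bsub>ell2 I\<^esub>"
      by (intro bexI[of _ "\<lambda>n. - f n"]) auto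
  qed (auto simp: algebra_simps summable_square_add)
  have "module (scalar_field UNIV) (ell2 I)"
    by (rule moduleI[OF cring ab])
      (auto simp: scalar_field_def algebra_simps summable_square_mult)
  then show ?thesis
  proof (rule inner_product_space.intro, unfold_locales)
    fix f g h a assume f: "f \<in> carrier (ell2 I)" and g: "g \<in> carrier (ell2 I)"
    show "ip (ell2 I) g f = cnj (ip (ell2 I) f g)"
      using f g sums_cnj[THEN iffD2, OF summable_sums[OF summable_inner[of f g]]]
      by (simp add: sums_iff mult.commute)
    show "ip (ell2 I) (a \<odot>\<^bsub>ell2 I\<^esub> f) g = a * ip (ell2 I) f g"
      using f g suminf_mult[OF summable_inner[of f g], of a] by (simp add: mult.assoc)
    assume h: "h \<in> carrier (ell2 I)"
    show "ip (ell2 I) (f \<oplus>\<^bsub>ell2 I\<^esub> g) h = ip (ell2 I) f h + ip (ell2 I) g h"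
      using f g h suminf_add[OF summable_inner[of f h] summable_inner[of g h]]
      by (simp add: distrib_right)
  next
    fix f assume f: "f \<in> carrier (ell2 I)"
    then show "0 \<le> Re (ip (ell2 I) f f)"
      by (simp add: ell2_inner_self suminf_nonneg)
    assume "ip (ell2 I) f f = 0"
    with f show "f = \<zero>\<^bsub>ell2 I\<^esub>"
      by (auto simp: ell2_inner_self suminf_eq_zero_iff)
  qed auto
qed

interpretation ell2: inner_product_space UNIV "ell2 I" for I
  by (rule inner_product_space_ell2)

lemma hnorm_ell2:
  assumes "summable (\<lambda>n. (cmod (f n))\<^sup>2)"
  shows "hnorm (ell2 I) f = sqrt (suminf (\<lambda>n. (cmod (f n))\<^sup>2))"
  using assms by (simp add: hnorm_def ell2_inner_self)

lemma minus_ell2: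
  assumes "f \<in> carrier (ell2 I)" "g \<in> carrier (ell2 I)"
  shows "f \<ominus>\<^bsub>ell2 I\<^esub> g = (\<lambda>n. f n - g n)"
proof -
  have "\<ominus>\<^bsub>ell2 I\<^esub> g = (\<lambda>n. - g n)"
    using assms by (intro ell2.M.minus_equality) auto
  then show ?thesis by (simp add: a_minus_def)
qed

lemma summable_square_diff:
  fixes f g :: "nat \<Rightarrow> complex"
  assumes "summable (\<lambda>n. (cmod (f n))\<^sup>2)" "summable (\<lambda>n. (cmod (g n))\<^sup>2)"
  shows "summable (\<lambda>n. (cmod (f n - g n))\<^sup>2)"
  using summable_square_add[of f "\<lambda>n. - g n"] assms by simp

text \<open>A Cauchy sequence converges in each coordinate. Its distance to the coordinatewise limit is
  controlled through finite partial sums, in which the limit can be taken under the sum; the bound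
  is uniform in the number of summands and so passes to the series.\<close>

lemma hilbert_space_ell2: "hilbert_space UNIV (ell2 I)"
proof (rule hilbert_space.intro[OF inner_product_space_ell2], unfold_locales)
  interpret Metric_space "carrier (ell2 I)" "hdist (ell2 I)"
    by (rule ell2.Metric_space_hdist)
  have dist: "hdist (ell2 I) f g = sqrt (suminf (\<lambda>n. (cmod (f n - g n))\<^sup>2))"
    if "f \<in> carrier (ell2 I)" "g \<in> carrier (ell2 I)" for f g
    using that minus_ell2[OF that] summable_square_diff[of f g]
    by (simp add: hdist_def hnorm_ell2)
  have partial: "(\<Sum>n<m. (cmod (f n - g n))\<^sup>2) \<le> (hdist (ell2 I) f g)\<^sup>2"
    if "f \<in> carrier (ell2 I)" "g \<in> carrier (ell2 I)" for f g m
    using that summable_square_diff[of f g]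
    by (subst dist) (auto intro!: sum_le_suminf simp: suminf_nonneg)
  show "mcomplete"
    unfolding mcomplete_def
  proof (intro allI impI)
    fix \<sigma> assume C: "MCauchy \<sigma>"
    then have \<sigma>: "\<sigma> k \<in> carrier (ell2 I)" for k by (auto simp: MCauchy_def simp del: ell2_simps(1))
    have close: "\<exists>N. \<forall>j\<ge>N. \<forall>k\<ge>N. hdist (ell2 I) (\<sigma> j) (\<sigma> k) < e" if "0 < e" for e
      using C that by (simp add: MCauchy_def del: ell2_simps(1))
    have "Cauchy (\<lambda>k. \<sigma> k n)" for n
    proof (rule CauchyI)
      fix e :: real assume "0 < e"
      then obtain N where N: "\<And>j k. j \<ge> N \<Longrightarrow> k \<ge> N \<Longrightarrow> hdist (ell2 I) (\<sigma> j) (\<sigma> k) < e"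
        using close[OF \<open>0 < e\<close>] by meson
      have "norm (\<sigma> j n - \<sigma> k n) < e" if jk: "j \<ge> N" "k \<ge> N" for j k
      proof -
        have "(cmod (\<sigma> j n - \<sigma> k n))\<^sup>2 \<le> (\<Sum>i<Suc n. (cmod (\<sigma> j i - \<sigma> k i))\<^sup>2)"
          by (simp add: sum_nonneg)
        also have "\<dots> \<le> (hdist (ell2 I) (\<sigma> j) (\<sigma> k))\<^sup>2" by (rule partial[OF \<sigma> \<sigma>])
        finally have "cmod (\<sigma> j n - \<sigma> k n) \<le> hdist (ell2 I) (\<sigma> j) (\<sigma> k)"
          by (rule power2_le_imp_le) simp
        with N[OF jk] show ?thesis by simp
      qed
      then show "\<exists>N. \<forall>j\<ge>N. \<forall>k\<ge>N. norm (\<sigma> j n - \<sigma> k n) < e" by blast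
    qed
    then have "\<exists>l. (\<lambda>k. \<sigma> k n) \<longlonglongrightarrow> l" for n
      by (simp add: Cauchy_convergent_iff convergent_def)
    then obtain x where x: "\<And>n. (\<lambda>k. \<sigma> k n) \<longlonglongrightarrow> x n"
      using choice[of "\<lambda>n l. (\<lambda>k. \<sigma> k n) \<longlonglongrightarrow> l"] by blast
    \<comment> \<open>Summability is part of the claim: it shows that \<open>\<sigma> j - x\<close>, and hence \<open>x\<close>, is in the space.\<close>
    have near: "\<exists>N. \<forall>j\<ge>N. summable (\<lambda>n. (cmod (\<sigma> j n - x n))\<^sup>2) \<and>
        suminf (\<lambda>n. (cmod (\<sigma> j n - x n))\<^sup>2) \<le> e\<^sup>2" if "0 < e" for e
    proof -
      obtain N where N: "\<And>j k. j \<ge> N \<Longrightarrow> k \<ge> N \<Longrightarrow> hdist (ell2 I) (\<sigma> j) (\<sigma> k) < e"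
        using close[OF \<open>0 < e\<close>] by meson
      have bound: "(\<Sum>n<m. (cmod (\<sigma> j n - x n))\<^sup>2) \<le> e\<^sup>2" if "j \<ge> N" for j m
      proof (rule tendsto_upperbound)
        show "(\<lambda>k. \<Sum>n<m. (cmod (\<sigma> j n - \<sigma> k n))\<^sup>2) \<longlonglongrightarrow> (\<Sum>n<m. (cmod (\<sigma> j n - x n))\<^sup>2)"
          by (intro tendsto_intros x)
        show "\<forall>\<^sub>F k in sequentially. (\<Sum>n<m. (cmod (\<sigma> j n - \<sigma> k n))\<^sup>2) \<le> e\<^sup>2"
          using eventually_ge_at_top[of N]
        proof eventually_elim
          case (elim k)
          have "(hdist (ell2 I) (\<sigma> j) (\<sigma> k))\<^sup>2 \<le> e\<^sup>2"
            using N[OF \<open>j \<ge> N\<close> elim] by (intro power_mono) auto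
          with partial[OF \<sigma> \<sigma>] show ?case by (rule order_trans)
        qed
      qed simp
      have "summable (\<lambda>n. (cmod (\<sigma> j n - x n))\<^sup>2)" if "j \<ge> N" for j
        by (rule summableI_nonneg_bounded[OF _ bound[OF that]]) simp
      with bound show ?thesis by (meson suminf_le_const)
    qed
    have x_in: "x \<in> carrier (ell2 I)"
    proof -
      obtain j where "summable (\<lambda>n. (cmod (\<sigma> j n - x n))\<^sup>2)"
        using near[of 1] by auto
      then have "summable (\<lambda>n. (cmod (x n))\<^sup>2)"
        using \<sigma>[of j] summable_square_diff[of "\<sigma> j" "\<lambda>n. \<sigma> j n - x n"] by simp
      moreover have "x n = 0" if "n \<notin> I" for n
        using x[of n] \<sigma> that by (simp add: LIMSEQ_const_iff)
      ultimately show ?thesis by simp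
    qed
    have "limitin mtopology \<sigma> x sequentially"
      unfolding limit_metric_sequentially
    proof (intro conjI allI impI x_in)
      fix e :: real assume "0 < e"
      then obtain N where N: "\<And>j. j \<ge> N \<Longrightarrow> suminf (\<lambda>n. (cmod (\<sigma> j n - x n))\<^sup>2) \<le> (e / 2)\<^sup>2"
        using near[of "e / 2"] by auto
      have "\<sigma> j \<in> carrier (ell2 I) \<and> hdist (ell2 I) (\<sigma> j) x < e" if "j \<ge> N" for j
      proof -
        have "sqrt (suminf (\<lambda>n. (cmod (\<sigma> j n - x n))\<^sup>2)) \<le> e / 2"
          using N[OF that] \<open>0 < e\<close> by (intro real_le_lsqrt) auto
        then show ?thesis using \<sigma>[of j] \<open>0 < e\<close> dist[OF \<sigma>[of j] x_in] by linarith
      qed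
      then show "\<exists>N. \<forall>j\<ge>N. \<sigma> j \<in> carrier (ell2 I) \<and> hdist (ell2 I) (\<sigma> j) x < e" by blast
    qed
    then show "\<exists>x. limitin mtopology \<sigma> x sequentially" by blast
  qed
qed

section \<open>Bounded operators\<close>

lemma linear_maps_minus:
  assumes "inner_product_space K E" "inner_product_space K F" "T \<in> linear_maps K E F"
    and x: "x \<in> carrier E" and y: "y \<in> carrier E"
  shows "T (x \<ominus>\<^bsub>E\<^esub> y) = T x \<ominus>\<^bsub>F\<^esub> T y"
proof -
  interpret E: inner_product_space K E by fact
  interpret F: inner_product_space K F by fact
  have T: "T v \<in> carrier F" "T (v \<oplus>\<^bsub>E\<^esub> w) = T v \<oplus>\<^bsub>F\<^esub> T w"
    if "v \<in> carrier E" "w \<in> carrier E" for v w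
    using assms(3) that by (auto simp: linear_maps_def)
  have "T (x \<ominus>\<^bsub>E\<^esub> y) \<oplus>\<^bsub>F\<^esub> T y = T x"
    using x y by (simp flip: T(2) add: a_minus_def E.M.a_assoc E.M.l_neg)
  then show ?thesis
    using x y T(1) by (metis E.M.minus_closed F.M.add.inv_solve_right' a_minus_def)
qed

lemma bounded_linear_map_continuous:
  assumes E: "inner_product_space K E" and F: "inner_product_space K F"
    and T: "T \<in> linear_maps K E F"
    and bound: "\<And>x. x \<in> carrier E \<Longrightarrow> hnorm F (T x) \<le> C * hnorm E x"
  shows "T \<in> continuous_linear_maps K E F"
proof -
  interpret E: inner_product_space K E by fact
  interpret F: inner_product_space K F by fact
  interpret ME: Metric_space "carrier E" "hdist E" by (rule E.Metric_space_hdist)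
  have maps: "T x \<in> carrier F" if "x \<in> carrier E" for x
    using T that by (auto simp: linear_maps_def)
  \<comment> \<open>The constant \<open>\<bar>C\<bar> + 1\<close> replaces \<open>C\<close> because it is positive, as the choice of \<open>\<delta>\<close> requires.\<close>
  have lip: "hdist F (T x) (T y) \<le> (\<bar>C\<bar> + 1) * hdist E x y"
    if "x \<in> carrier E" "y \<in> carrier E" for x y
  proof -
    have d: "x \<ominus>\<^bsub>E\<^esub> y \<in> carrier E" using that by simp
    have "hdist F (T x) (T y) = hnorm F (T (x \<ominus>\<^bsub>E\<^esub> y))"
      using that maps by (simp add: hdist_def linear_maps_minus[OF E F T])
    also have "\<dots> \<le> C * hnorm E (x \<ominus>\<^bsub>E\<^esub> y)" by (rule bound[OF d])
    also have "\<dots> \<le> (\<bar>C\<bar> + 1) * hnorm E (x \<ominus>\<^bsub>E\<^esub> y)"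
      by (intro mult_right_mono E.hnorm_nonneg d) simp
    finally show ?thesis using that by (simp add: hdist_def)
  qed
  have "continuous_map (htopology E) (htopology F) T"
    unfolding ME.metric_continuous_map[OF F.Metric_space_hdist]
  proof (intro conjI ballI allI impI)
    fix a e assume a: "a \<in> carrier E" and e: "0 < (e::real)"
    show "\<exists>\<delta>>0. \<forall>x. x \<in> carrier E \<and> hdist E a x < \<delta> \<longrightarrow> hdist F (T a) (T x) < e"
    proof (intro exI[of _ "e / (\<bar>C\<bar> + 1)"] conjI allI impI)
      fix x assume "x \<in> carrier E \<and> hdist E a x < e / (\<bar>C\<bar> + 1)"
      then show "hdist F (T a) (T x) < e"
        using lip[OF a, of x] by (simp add: field_simps)
    qed (use e in simp)
  qed (use maps in auto)
  with T show ?thesis by (simp add: continuous_linear_maps_def)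
qed

lemma zero_map_continuous:
  assumes E: "inner_product_space K E" and F: "inner_product_space K F"
  shows "(\<lambda>x. \<zero>\<^bsub>F\<^esub>) \<in> continuous_linear_maps K E F"
proof (rule bounded_linear_map_continuous[OF E F, where C = 0])
  interpret F: inner_product_space K F by fact
  show "(\<lambda>x. \<zero>\<^bsub>F\<^esub>) \<in> linear_maps K E F"
    using F.smult_r_null by (auto simp: linear_maps_def)
  show "hnorm F \<zero>\<^bsub>F\<^esub> \<le> 0 * hnorm E x" for x
    using F.hnorm_0_iff[of "\<zero>\<^bsub>F\<^esub>"] by simp
qed

lemma identity_continuous:
  assumes "inner_product_space K E"
  shows "(\<lambda>x. x) \<in> continuous_linear_maps K E E"
  by (rule bounded_linear_map_continuous[OF assms assms, where C = 1])
    (auto simp: linear_maps_def)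

section \<open>A functional vanishing on a subspace\<close>

text \<open>Adding \<open>u\<close> to a Hamel basis of \<open>S\<close> keeps it independent, so the values 0 on the basis and 1 at
  \<open>u\<close> extend to a linear functional. The argument is purely algebraic, so it also
  covers dense \<open>S\<close>.\<close>

lemma (in Vector_Spaces.vector_space) functional_vanishing_on_subspace:
  assumes S: "subspace S" and u: "u \<notin> S"
  shows "\<exists>g. Vector_Spaces.linear scale (*) g \<and> g u = 1 \<and> (\<forall>s\<in>S. g s = 0)"
proof -
  interpret pair: vector_space_pair scale "(*)"
    by unfold_locales (auto simp: algebra_simps)
  obtain B where B: "B \<subseteq> S" "independent B" "S \<subseteq> span B"
    using maximal_independent_subset by blast
  have "span B \<subseteq> S" using B(1) S by (rule span_minimal)
  with u have "u \<notin> span B" by blast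
  with B(2) have "independent (insert u B)" by (simp add: independent_insertI)
  then obtain g where g: "Vector_Spaces.linear scale (*) g"
    and gB: "\<forall>x\<in>insert u B. g x = (if x = u then 1 else 0)"
    using pair.linear_independent_extend[of "insert u B" "\<lambda>x. if x = u then 1 else 0"] by blast
  have "g s = 0" if "s \<in> S" for s
  proof (rule pair.linear_eq_0_on_span[OF g])
    show "g b = 0" if "b \<in> B" for b
      using gB B(1) u that by (metis insertCI subsetD)
    show "s \<in> span B" using B(3) that by blast
  qed
  with g gB show ?thesis by auto
qed

section \<open>Multiplication by the harmonic sequence\<close>

definition harmonic :: "nat \<Rightarrow> complex" where
  "harmonic n = 1 / of_nat (Suc n)"

definition harmonic_mult :: "(nat \<Rightarrow> complex) \<Rightarrow> nat \<Rightarrow> complex" where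
  "harmonic_mult f n = f n * harmonic n"

definition at_zero :: "complex \<Rightarrow> nat \<Rightarrow> complex" where
  "at_zero c n = (if n = 0 then c else 0)"

lemma at_zero_sums: "f 0 = (c::'a::real_normed_vector) \<Longrightarrow> (\<And>n. n \<noteq> 0 \<Longrightarrow> f n = 0) \<Longrightarrow> f sums c"
  using sums_finite[of "{0}" f] by auto

lemma at_zero_in [simp]: "at_zero c \<in> carrier (ell2 {0})"
  using at_zero_sums[of "\<lambda>n. (cmod (at_zero c n))\<^sup>2"] by (auto simp: at_zero_def sums_iff)

lemma hnorm_at_zero: "hnorm (ell2 {0}) (at_zero c) = cmod c"
  using at_zero_in[of c] at_zero_sums[of "\<lambda>n. (cmod (at_zero c n))\<^sup>2" "(cmod c)\<^sup>2"]
  by (simp add: hnorm_ell2 at_zero_def sums_iff del: at_zero_in)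

lemma ip_ell2_zero:
  assumes "f \<in> carrier (ell2 {0})"
  shows "ip (ell2 {0}) f g = f 0 * cnj (g 0)"
  using assms at_zero_sums[of "\<lambda>n. f n * cnj (g n)"] by (simp add: sums_iff)

lemma eq_at_zero: "f \<in> carrier (ell2 {0}) \<Longrightarrow> f = at_zero (f 0)"
  by (auto simp: at_zero_def)

lemma harmonic_nonzero [simp]: "harmonic n \<noteq> 0"
  unfolding harmonic_def by (simp del: of_nat_Suc)

lemma cnj_harmonic [simp]: "cnj (harmonic n) = harmonic n"
  by (simp add: harmonic_def)

lemma norm_harmonic: "cmod (harmonic n) = 1 / real (Suc n)"
  unfolding harmonic_def norm_divide norm_of_nat by simp

lemma summable_harmonic: "summable (\<lambda>n. (cmod (harmonic n))\<^sup>2)"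
  using inverse_power_summable[of 2, where 'a = real] summable_Suc_iff[of "\<lambda>n. inverse ((real n)\<^sup>2)"]
  by (simp add: norm_harmonic divide_inverse power_inverse del: of_nat_Suc)

lemma norm_harmonic_mult_le: "cmod (harmonic_mult f n) \<le> cmod (f n)"
proof -
  have "cmod (f n) * (1 / real (Suc n)) \<le> cmod (f n) * 1"
    by (intro mult_left_mono) auto
  then show ?thesis by (simp add: harmonic_mult_def norm_mult norm_harmonic)
qed

lemma harmonic_mult_in:
  assumes "f \<in> carrier (ell2 UNIV)"
  shows "harmonic_mult f \<in> carrier (ell2 UNIV)"
proof -
  have "summable (\<lambda>n. (cmod (harmonic_mult f n))\<^sup>2)"
    by (rule summable_comparison_test'[of "\<lambda>n. (cmod (f n))\<^sup>2"])
      (use assms norm_harmonic_mult_le[of f] in \<open>auto intro: power_mono\<close>)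
  then show ?thesis by simp
qed

text \<open>The multiplier is bounded by 1, so the operator is a contraction.\<close>

lemma harmonic_mult_continuous:
  "harmonic_mult \<in> continuous_linear_maps UNIV (ell2 UNIV) (ell2 UNIV)"
proof (rule bounded_linear_map_continuous[OF inner_product_space_ell2 inner_product_space_ell2, where C = 1])
  show "harmonic_mult \<in> linear_maps UNIV (ell2 UNIV) (ell2 UNIV)"
    using harmonic_mult_in by (auto simp: linear_maps_def harmonic_mult_def fun_eq_iff algebra_simps)
  fix f assume f: "f \<in> carrier (ell2 UNIV)"
  have "suminf (\<lambda>n. (cmod (harmonic_mult f n))\<^sup>2) \<le> suminf (\<lambda>n. (cmod (f n))\<^sup>2)"
    using f harmonic_mult_in[OF f] norm_harmonic_mult_le[of f]
    by (intro suminf_le power_mono) auto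
  then show "hnorm (ell2 UNIV) (harmonic_mult f) \<le> 1 * hnorm (ell2 UNIV) f"
    using f harmonic_mult_in[OF f] by (simp add: hnorm_ell2)
qed

definition harmonic_pairing :: "(nat \<Rightarrow> complex) \<Rightarrow> nat \<Rightarrow> complex" where
  "harmonic_pairing f = at_zero (ip (ell2 UNIV) f harmonic)"

lemma harmonic_in: "harmonic \<in> carrier (ell2 UNIV)"
  using summable_harmonic by simp

lemma harmonic_pairing_continuous:
  "harmonic_pairing \<in> continuous_linear_maps UNIV (ell2 UNIV) (ell2 {0})"
proof (rule bounded_linear_map_continuous[OF inner_product_space_ell2 inner_product_space_ell2])
  show "harmonic_pairing \<in> linear_maps UNIV (ell2 UNIV) (ell2 {0})"
    unfolding linear_maps_def
  proof (intro CollectI conjI ballI Pi_I)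
    show "harmonic_pairing f \<in> carrier (ell2 {0})" for f
      unfolding harmonic_pairing_def by (rule at_zero_in)
  next
    fix f g assume "f \<in> carrier (ell2 UNIV)" "g \<in> carrier (ell2 UNIV)"
    from ell2.ip_add_left[OF this harmonic_in]
    show "harmonic_pairing (f \<oplus>\<^bsub>ell2 UNIV\<^esub> g) = harmonic_pairing f \<oplus>\<^bsub>ell2 {0}\<^esub> harmonic_pairing g"
      unfolding harmonic_pairing_def by (simp add: at_zero_def fun_eq_iff del: ell2_simps(5))
  next
    fix a f assume "a \<in> (UNIV :: complex set)" "f \<in> carrier (ell2 UNIV)"
    from ell2.ip_smult_left[OF this harmonic_in]
    show "harmonic_pairing (a \<odot>\<^bsub>ell2 UNIV\<^esub> f) = a \<odot>\<^bsub>ell2 {0}\<^esub> harmonic_pairing f"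
      unfolding harmonic_pairing_def by (simp add: at_zero_def fun_eq_iff del: ell2_simps(5))
  qed
  show "hnorm (ell2 {0}) (harmonic_pairing f) \<le> hnorm (ell2 UNIV) harmonic * hnorm (ell2 UNIV) f"
    if "f \<in> carrier (ell2 UNIV)" for f
    unfolding harmonic_pairing_def hnorm_at_zero
    using ell2.Cauchy_Schwarz[OF that harmonic_in] by (simp only: mult.commute)
qed

text \<open>The multiplier is real, so the operator is self-adjoint.\<close>

lemma adjoint_harmonic_mult:
  assumes "h \<in> carrier (ell2 UNIV)"
  shows "adjoint_map (ell2 UNIV) (ell2 UNIV) harmonic_mult h = harmonic_mult h"
  by (rule adjoint_map_eqI[OF inner_product_space_ell2 harmonic_mult_in[OF assms]])
    (simp add: harmonic_mult_def mult_ac)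

lemma adjoint_zero_map:
  assumes E: "inner_product_space K E" and F: "inner_product_space K F" and y: "y \<in> carrier F"
  shows "adjoint_map E F (\<lambda>x. \<zero>\<^bsub>F\<^esub>) y = \<zero>\<^bsub>E\<^esub>"
proof -
  interpret E: inner_product_space K E by fact
  interpret F: inner_product_space K F by fact
  show ?thesis
    by (rule adjoint_map_eqI[OF E]) (use y in \<open>auto simp: E.ip_zero_right F.ip_zero_left\<close>)
qed

lemma adjoint_zero_pair_id:
  assumes E: "inner_product_space K E" and F: "inner_product_space K F"
    and y: "y \<in> carrier F" and z: "z \<in> carrier E"
  shows "adjoint_map E (F \<times>\<^sub>H E) (\<lambda>x. (\<zero>\<^bsub>F\<^esub>, x)) (y, z) = z"
  by (rule adjoint_map_eqI[OF E z])
    (simp add: hprod_def inner_product_space.ip_zero_left[OF F y])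

text \<open>The adjoint of a pair of operators is the sum of the adjoints; that of the functional
  \<open>\<langle>_, u\<rangle>\<close> maps \<open>k\<close> to \<open>k u\<close>.\<close>

lemma adjoint_harmonic_pair:
  assumes h: "h \<in> carrier (ell2 UNIV)" and k: "k \<in> carrier (ell2 {0})"
  shows "adjoint_map (ell2 UNIV) (ell2 UNIV \<times>\<^sub>H ell2 {0})
      (\<lambda>f. (harmonic_mult f, harmonic_pairing f)) (h, k)
    = (\<lambda>n. harmonic_mult h n + k 0 * harmonic n)"
proof (rule adjoint_map_eqI[OF inner_product_space_ell2])
  have kh: "(\<lambda>n. k 0 * harmonic n) \<in> carrier (ell2 UNIV)"
    using summable_square_mult[OF summable_harmonic] by simp
  show "(\<lambda>n. harmonic_mult h n + k 0 * harmonic n) \<in> carrier (ell2 UNIV)"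
    using ell2.M.add.m_closed[OF harmonic_mult_in[OF h] kh] by simp
  fix f assume f: "f \<in> carrier (ell2 UNIV)"
  have "ip (ell2 UNIV) f (\<lambda>n. harmonic_mult h n + k 0 * harmonic n)
      = ip (ell2 UNIV) f (harmonic_mult h) + ip (ell2 UNIV) f (\<lambda>n. k 0 * harmonic n)"
    using ell2.ip_add_right[OF harmonic_mult_in[OF h] kh f] by (simp only: ell2_simps(3))
  also have "ip (ell2 UNIV) f (\<lambda>n. k 0 * harmonic n) = cnj (k 0) * ip (ell2 UNIV) f harmonic"
    using ell2.ip_smult_right[OF UNIV_I harmonic_in f] by (simp only: ell2_simps(4))
  also have "ip (ell2 UNIV) f (harmonic_mult h) = ip (ell2 UNIV) (harmonic_mult f) h"
    by (simp add: harmonic_mult_def mult_ac)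
  also have "cnj (k 0) * ip (ell2 UNIV) f harmonic = ip (ell2 {0}) (harmonic_pairing f) k"
    unfolding harmonic_pairing_def ip_ell2_zero[OF at_zero_in] by (simp add: at_zero_def)
  finally show "ip (ell2 UNIV \<times>\<^sub>H ell2 {0}) (harmonic_mult f, harmonic_pairing f) (h, k)
      = ip (ell2 UNIV) f (\<lambda>n. harmonic_mult h n + k 0 * harmonic n)"
    by (simp add: hprod_def)
qed

lemma const_not_square_summable:
  assumes "summable (\<lambda>n. (cmod (c::complex))\<^sup>2)"
  shows "c = 0"
  using summable_LIMSEQ_zero[OF assms] by (simp add: LIMSEQ_const_iff)

text \<open>Dividing the harmonic sequence by its own entries leaves the constant sequence 1, which is not
  square-summable.\<close>

lemma harmonic_notin_range: "harmonic \<notin> harmonic_mult ` carrier (ell2 UNIV)"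
proof
  assume "harmonic \<in> harmonic_mult ` carrier (ell2 UNIV)"
  then obtain f where f: "f \<in> carrier (ell2 UNIV)" and "harmonic = harmonic_mult f" by blast
  then have "f n = 1" for n
    by (metis harmonic_mult_def harmonic_nonzero mult_cancel_right1)
  with f have "summable (\<lambda>n::nat. (cmod 1)\<^sup>2)" by simp
  then show False using const_not_square_summable[of 1] by simp
qed

interpretation sequences: Vector_Spaces.vector_space "\<lambda>(a::complex) (f::nat \<Rightarrow> complex) n. a * f n"
  by unfold_locales (auto simp: fun_eq_iff algebra_simps)

text \<open>This functional recovers \<open>k\<close> from \<open>M h + k u\<close>, where \<open>M\<close> is multiplication by the harmonic
  sequence \<open>u\<close>, and thus provides the discontinuous \<open>D\<close> in \<open>A\<^sup>* = D B\<^sup>*\<close>.\<close>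

lemma harmonic_functional:
  obtains g :: "(nat \<Rightarrow> complex) \<Rightarrow> complex"
  where "\<And>f f'. g (\<lambda>n. f n + f' n) = g f + g f'"
    and "\<And>a f. g (\<lambda>n. a * f n) = a * g f"
    and "g harmonic = 1"
    and "\<And>f. f \<in> carrier (ell2 UNIV) \<Longrightarrow> g (harmonic_mult f) = 0"
proof -
  have "sequences.subspace (harmonic_mult ` carrier (ell2 UNIV))"
  proof (rule sequences.subspaceI)
    show "0 \<in> harmonic_mult ` carrier (ell2 UNIV)"
      by (rule image_eqI[of _ _ "\<lambda>n. 0"]) (auto simp: harmonic_mult_def fun_eq_iff)
  next
    fix x y assume "x \<in> harmonic_mult ` carrier (ell2 UNIV)" "y \<in> harmonic_mult ` carrier (ell2 UNIV)"
    then obtain f g where "f \<in> carrier (ell2 UNIV)" "x = harmonic_mult f"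
      and "g \<in> carrier (ell2 UNIV)" "y = harmonic_mult g" by blast
    then show "x + y \<in> harmonic_mult ` carrier (ell2 UNIV)"
      by (intro image_eqI[of _ _ "\<lambda>n. f n + g n"])
        (auto simp: harmonic_mult_def fun_eq_iff algebra_simps summable_square_add)
  next
    fix a x assume "x \<in> harmonic_mult ` carrier (ell2 UNIV)"
    then obtain f where "f \<in> carrier (ell2 UNIV)" "x = harmonic_mult f" by blast
    then show "(\<lambda>n. a * x n) \<in> harmonic_mult ` carrier (ell2 UNIV)"
      by (intro image_eqI[of _ _ "\<lambda>n. a * f n"])
        (auto simp: harmonic_mult_def fun_eq_iff summable_square_mult)
  qed
  from sequences.functional_vanishing_on_subspace[OF this harmonic_notin_range]
  obtain g where g: "Vector_Spaces.linear (\<lambda>(a::complex) (f::nat \<Rightarrow> complex) n. a * f n) (*) g"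
    and g1: "g harmonic = 1" and g0: "\<forall>s\<in>harmonic_mult ` carrier (ell2 UNIV). g s = 0" by blast
  interpret g: Vector_Spaces.linear "\<lambda>(a::complex) (f::nat \<Rightarrow> complex) n. a * f n" "(*)" g by (rule g)
  show thesis
  proof (rule that[of g])
    show "g (\<lambda>n. f n + f' n) = g f + g f'" for f f'
      using g.add[of f f'] by (simp add: plus_fun_def)
  qed (use g.scale g1 g0 in auto)
qed

text \<open>Cancelling the harmonic factor shows that \<open>h\<close> is constantly \<open>- k 0\<close>, and the only
  square-summable constant is 0.\<close>

lemma harmonic_pair_adjoint_kernel:
  assumes h: "h \<in> carrier (ell2 UNIV)" and k: "k \<in> carrier (ell2 {0})"
    and eq: "\<And>n. harmonic_mult h n + k 0 * harmonic n = 0"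
  shows "k = (\<lambda>n. 0)"
proof -
  have "h n = - k 0" for n
  proof -
    have "(h n + k 0) * harmonic n = 0" using eq[of n] by (simp add: harmonic_mult_def distrib_right)
    then show ?thesis by (simp add: eq_neg_iff_add_eq_0)
  qed
  with h have "k 0 = 0" using const_not_square_summable[of "k 0"] by simp
  then show ?thesis using eq_at_zero[OF k] by (simp add: at_zero_def fun_eq_iff)
qed

theorem proposition2p3:
  shows "\<exists>(K :: complex set)
      (H1 :: (nat \<Rightarrow> complex) hilb) (H2 :: (nat \<Rightarrow> complex) hilb)
      (H4 :: (nat \<Rightarrow> complex) hilb) (H5 :: (nat \<Rightarrow> complex) hilb) A1 A2 B1 B2 A B.
    hilbert_space K H1 \<and> hilbert_space K H2 \<and> hilbert_space K H4 \<and> hilbert_space K H5 \<and>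
    A1 \<in> continuous_linear_maps K H1 H4 \<and> A2 \<in> continuous_linear_maps K H1 H5 \<and>
    B1 \<in> continuous_linear_maps K H2 H4 \<and> B2 \<in> continuous_linear_maps K H2 H5 \<and>
    A = (\<lambda>h. (A1 h, A2 h)) \<and> B = (\<lambda>h. (B1 h, B2 h)) \<and>
    ((\<exists>C>0. \<forall>h4\<in>carrier H4.
        hnorm H1 (adjoint_map H1 H4 A1 h4) \<le> C * hnorm H2 (adjoint_map H2 H4 B1 h4)) \<and>
     a_kernel (H4 \<times>\<^sub>H H5) H2 (adjoint_map H2 (H4 \<times>\<^sub>H H5) B)
       \<subseteq> a_kernel (H4 \<times>\<^sub>H H5) H1 (adjoint_map H1 (H4 \<times>\<^sub>H H5) A)) \<and>
    ((\<exists>C1\<in>continuous_linear_maps K H1 H2. \<forall>h1\<in>carrier H1. A1 h1 = B1 (C1 h1)) \<and>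
     (\<exists>D\<in>linear_maps K H2 H1. \<forall>h\<in>carrier (H4 \<times>\<^sub>H H5).
        adjoint_map H1 (H4 \<times>\<^sub>H H5) A h = D (adjoint_map H2 (H4 \<times>\<^sub>H H5) B h))) \<and>
    \<not> (\<forall>h1\<in>carrier H1. \<forall>\<epsilon>>0. \<exists>h2\<in>carrier H2.
        A1 h1 = B1 h2 \<and> hnorm H5 (A2 h1 \<ominus>\<^bsub>H5\<^esub> B2 h2) \<le> \<epsilon>)"
proof -
  let ?X = "ell2 UNIV" and ?Y = "ell2 {0}"
  let ?A1 = "\<lambda>f::nat \<Rightarrow> complex. \<zero>\<^bsub>?X\<^esub>" and ?A2 = "\<lambda>f::nat \<Rightarrow> complex. f"
  let ?A = "\<lambda>f. (?A1 f, ?A2 f)" and ?B = "\<lambda>f. (harmonic_mult f, harmonic_pairing f)"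
  note ips = inner_product_space_ell2
  have Astar: "adjoint_map ?Y (?X \<times>\<^sub>H ?Y) ?A (h, k) = k"
    if "h \<in> carrier ?X" "k \<in> carrier ?Y" for h k
    using that by (rule adjoint_zero_pair_id[OF ips ips])
  have lower: "\<exists>C>0. \<forall>h4\<in>carrier ?X. hnorm ?Y (adjoint_map ?Y ?X ?A1 h4)
      \<le> C * hnorm ?X (adjoint_map ?X ?X harmonic_mult h4)"
  proof (intro exI[of _ "1::real"] conjI ballI)
    fix h assume h: "h \<in> carrier ?X"
    have "hnorm ?Y (adjoint_map ?Y ?X ?A1 h) = 0"
      unfolding adjoint_zero_map[OF ips ips h] by (simp add: ell2.hnorm_0_iff del: ell2_simps(1,2))
    also have "0 \<le> hnorm ?X (adjoint_map ?X ?X harmonic_mult h)"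
      unfolding adjoint_harmonic_mult[OF h] by (rule ell2.hnorm_nonneg[OF harmonic_mult_in[OF h]])
    finally show "hnorm ?Y (adjoint_map ?Y ?X ?A1 h) \<le> 1 * hnorm ?X (adjoint_map ?X ?X harmonic_mult h)"
      by simp
  qed simp
  have kernel: "a_kernel (?X \<times>\<^sub>H ?Y) ?X (adjoint_map ?X (?X \<times>\<^sub>H ?Y) ?B)
      \<subseteq> a_kernel (?X \<times>\<^sub>H ?Y) ?Y (adjoint_map ?Y (?X \<times>\<^sub>H ?Y) ?A)"
  proof
    fix p assume p: "p \<in> a_kernel (?X \<times>\<^sub>H ?Y) ?X (adjoint_map ?X (?X \<times>\<^sub>H ?Y) ?B)"
    then obtain h k where hk: "p = (h, k)" "h \<in> carrier ?X" "k \<in> carrier ?Y"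
      and eq: "adjoint_map ?X (?X \<times>\<^sub>H ?Y) ?B (h, k) = (\<lambda>n. 0)"
      unfolding a_kernel_def' by (cases p) (auto simp: hprod_def simp del: ell2_simps(1))
    have "k = (\<lambda>n. 0)"
      by (rule harmonic_pair_adjoint_kernel[OF hk(2,3)])
        (use fun_cong[OF eq[unfolded adjoint_harmonic_pair[OF hk(2,3)]]] in simp)
    then have "adjoint_map ?Y (?X \<times>\<^sub>H ?Y) ?A p = \<zero>\<^bsub>?Y\<^esub>"
      unfolding hk(1) Astar[OF hk(2,3)] by simp
    with p show "p \<in> a_kernel (?X \<times>\<^sub>H ?Y) ?Y (adjoint_map ?Y (?X \<times>\<^sub>H ?Y) ?A)"
      unfolding a_kernel_def' by blast
  qed
  have factor: "\<exists>C1\<in>continuous_linear_maps UNIV ?Y ?X. \<forall>f\<in>carrier ?Y. ?A1 f = harmonic_mult (C1 f)"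
    by (rule bexI[OF _ zero_map_continuous[OF ips ips]]) (auto simp: harmonic_mult_def)
  have algebraic: "\<exists>D\<in>linear_maps UNIV ?X ?Y. \<forall>h\<in>carrier (?X \<times>\<^sub>H ?Y).
      adjoint_map ?Y (?X \<times>\<^sub>H ?Y) ?A h = D (adjoint_map ?X (?X \<times>\<^sub>H ?Y) ?B h)"
  proof -
    obtain g where g_add: "\<And>f f'. g (\<lambda>n. f n + f' n) = g f + g f'"
      and g_mult: "\<And>a f. g (\<lambda>n. a * f n) = a * g f"
      and g1: "g harmonic = 1"
      and g0: "\<And>f. f \<in> carrier ?X \<Longrightarrow> g (harmonic_mult f) = 0"
      using harmonic_functional by blast
    have "(\<lambda>f. at_zero (g f)) \<in> linear_maps UNIV ?X ?Y"
      using at_zero_in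
      by (auto simp: linear_maps_def g_add g_mult at_zero_def fun_eq_iff)
    moreover have "adjoint_map ?Y (?X \<times>\<^sub>H ?Y) ?A p = at_zero (g (adjoint_map ?X (?X \<times>\<^sub>H ?Y) ?B p))"
      if "p \<in> carrier (?X \<times>\<^sub>H ?Y)" for p
    proof -
      from that obtain h k where hk: "p = (h, k)" "h \<in> carrier ?X" "k \<in> carrier ?Y"
        by (cases p) (auto simp: hprod_def simp del: ell2_simps(1))
      have "g (adjoint_map ?X (?X \<times>\<^sub>H ?Y) ?B (h, k)) = k 0"
        unfolding adjoint_harmonic_pair[OF hk(2,3)] g_add g_mult g1 g0[OF hk(2)] by simp
      with hk show ?thesis using Astar[OF hk(2,3)] eq_at_zero[OF hk(3)] by simp
    qed
    ultimately show ?thesis by (intro bexI[of _ "\<lambda>f. at_zero (g f)"]) blast+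
  qed
  have fails: "\<not> (\<forall>h1\<in>carrier ?Y. \<forall>\<epsilon>>0. \<exists>h2\<in>carrier ?X.
      ?A1 h1 = harmonic_mult h2 \<and> hnorm ?Y (?A2 h1 \<ominus>\<^bsub>?Y\<^esub> harmonic_pairing h2) \<le> \<epsilon>)"
  proof
    assume "\<forall>h1\<in>carrier ?Y. \<forall>\<epsilon>>0. \<exists>h2\<in>carrier ?X.
      ?A1 h1 = harmonic_mult h2 \<and> hnorm ?Y (?A2 h1 \<ominus>\<^bsub>?Y\<^esub> harmonic_pairing h2) \<le> \<epsilon>"
    from this[rule_format, OF at_zero_in[of 1], of "1/2"]
    obtain f where f0: "\<zero>\<^bsub>?X\<^esub> = harmonic_mult f"
      and near: "hnorm ?Y (at_zero 1 \<ominus>\<^bsub>?Y\<^esub> harmonic_pairing f) \<le> 1/2" by auto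
    have "f n = 0" for n
      using fun_cong[OF f0, of n] by (simp add: harmonic_mult_def)
    then have "harmonic_pairing f = at_zero 0" by (simp add: harmonic_pairing_def)
    then have "at_zero 1 \<ominus>\<^bsub>?Y\<^esub> harmonic_pairing f = at_zero 1"
      by (simp only: minus_ell2[OF at_zero_in at_zero_in]) (simp add: at_zero_def fun_eq_iff)
    with near show False by (simp add: hnorm_at_zero)
  qed
  show ?thesis
    by (rule exI[of _ UNIV], rule exI[of _ ?Y], rule exI[of _ ?X], rule exI[of _ ?X],
        rule exI[of _ ?Y], rule exI[of _ ?A1], rule exI[of _ ?A2], rule exI[of _ harmonic_mult],
        rule exI[of _ harmonic_pairing], rule exI[of _ ?A], rule exI[of _ ?B])
      (intro conjI refl hilbert_space_ell2 zero_map_continuous[OF ips ips]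
        identity_continuous[OF ips] harmonic_mult_continuous harmonic_pairing_continuous
        lower kernel factor algebraic fails)
qed

end
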